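(* Let $p=(12,R)$ be the mesh pattern with $R=\{(0,0),(0,1),(1,1),(1,2),(2,1),(2,2)\}$. Let $F(x)=\sum_{n\ge0}n!\,x^n$, $F(x,q)=\sum_{n\ge 0}x^n\sum_{\pi\in S_n}q^{p(\pi)}$, and $A(x)=\sum_{n\ge0}|S_n(p)|x^n$. Then, as formal power series in $x$, $$A(x) = \frac{F(x)}{1-x+xF(x)},\qquad F(x,q) = \frac{F(x)}{1+(1-q)x(F(x)-1)}.$$
   Context: $S_n$ is the set of permutations $\pi=\pi_1\cdots\pi_n$ of $\{1,\dots,n\}$ ($S_0$ contains only the empty permutation). A mesh pattern $(12,R)$ consists of the permutation $12$ and a set $R\subseteq\{0,1,2\}\times\{0,1,2\}$ of shaded boxes. An occurrence of $(12,R)$ in $\pi\in S_n$ is a pair of positions $s<t$ with $\pi_s<\pi_t$ such that, putting $s_0=0,\ s_1=s,\ s_2=t,\ s_3=n+1$ and $v_0=0,\ v_1=\pi_s,\ v_2=\pi_t,\ v_3=n+1$, for every $(i,j)\in R$ there is no position $m$ with $s_i<m<s_{i+1}$ and $v_j<\pi_m<v_{j+1}$. $p(\pi)$ is the number of occurrences of $p$ in $\pi$, and $S_n(p)$ is the set of $\pi\in S_n$ with $p(\pi)=0$ (permutations avoiding $p$). *)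

theory Defs
  imports
    "HOL-Combinatorics.Permutations"
    "HOL-Computational_Algebra.Formal_Power_Series"
    "HOL-Computational_Algebra.Polynomial"
    "HOL-Computational_Algebra.Fraction_Field"
begin

definition perms :: "nat \<Rightarrow> (nat \<Rightarrow> nat) set" where
  "perms n = {\<pi>. \<pi> permutes {1..n}}"

text \<open>
  Box \<open>(i, j)\<close> consists of the points strictly between the \<open>i\<close>-th and the \<open>(i+1)\<close>-st vertical
  line (at \<open>0, s, t, n + 1\<close>) and strictly between the \<open>j\<close>-th and the \<open>(j+1)\<close>-st horizontal line
  (at \<open>0, \<pi> s, \<pi> t, n + 1\<close>). The shading \<open>R\<close> is meant to be a subset of \<open>{0,1,2} \<times> {0,1,2}\<close>.
\<close>

definition mesh12_occurrences ::
    "(nat \<times> nat) set \<Rightarrow> nat \<Rightarrow> (nat \<Rightarrow> nat) \<Rightarrow> (nat \<times> nat) set" where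
  "mesh12_occurrences R n \<pi> =
     {(s, t). s \<in> {1..n} \<and> t \<in> {1..n} \<and> s < t \<and> \<pi> s < \<pi> t \<and>
        (\<forall>(i, j) \<in> R. \<not> (\<exists>m \<in> {1..n}.
            [0, s, t, n + 1] ! i < m \<and> m < [0, s, t, n + 1] ! (i + 1) \<and>
            [0, \<pi> s, \<pi> t, n + 1] ! j < \<pi> m \<and> \<pi> m < [0, \<pi> s, \<pi> t, n + 1] ! (j + 1)))}"

definition mesh12_count :: "(nat \<times> nat) set \<Rightarrow> nat \<Rightarrow> (nat \<Rightarrow> nat) \<Rightarrow> nat" where
  "mesh12_count R n \<pi> = card (mesh12_occurrences R n \<pi>)"

definition mesh12_avoiders :: "(nat \<times> nat) set \<Rightarrow> nat \<Rightarrow> (nat \<Rightarrow> nat) set" where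
  "mesh12_avoiders R n = {\<pi> \<in> perms n. mesh12_count R n \<pi> = 0}"

definition fact_gf :: "'a::semiring_1 fps" where
  "fact_gf = Abs_fps (\<lambda>n. of_nat (fact n))"

definition avoiders_gf :: "(nat \<times> nat) set \<Rightarrow> rat fps" where
  "avoiders_gf R = Abs_fps (\<lambda>n. of_nat (card (mesh12_avoiders R n)))"

text \<open>
  The variable \<open>q\<close> is an indeterminate. The series \<open>F(x, q)\<close> has coefficients in \<open>\<int>[q]\<close>; they are
  regarded as elements of the fraction field of \<open>\<int>[q]\<close> so that the division of formal power series
  in \<open>x\<close> is available.
\<close>

definition q_var :: "int poly fract" where
  "q_var = Fract [:0, 1:] 1"

definition mesh12_gf :: "(nat \<times> nat) set \<Rightarrow> int poly fract fps" where
  "mesh12_gf R = Abs_fps (\<lambda>n. \<Sum>\<pi>\<in>perms n. q_var ^ mesh12_count R n \<pi>)"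

end

theory Submission
  imports Defs
begin

text \<open>
  For the shading in question an occurrence \<open>(s, t)\<close> of the pattern forces every entry to the left
  of \<open>s\<close> to exceed \<open>\<pi> t\<close> and every other entry, apart from the two occurrence points, to lie below
  \<open>\<pi> s\<close>. Counting values then gives \<open>\<pi> s = n - s\<close> and \<open>\<pi> t = n - s + 1\<close>. So \<open>t\<close> is determined by
  \<open>s\<close>, and \<open>s = k + 1\<close> starts an occurrence iff \<open>\<pi>\<close> is a skew sum of a permutation \<open>L\<close> of size \<open>k\<close>
  (placed above and to the left) and a permutation \<open>\<sigma>\<close> of size \<open>m = n - k \<ge> 2\<close> with \<open>\<sigma> 1 = m - 1\<close>.
  Moreover the starts before \<open>s\<close> are exactly the starts in \<open>L\<close>, whatever \<open>\<sigma>\<close> is.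

  Let \<open>O\<close> be the set of starts of \<open>\<pi>\<close>. Summing the telescoping identity
  \<open>q\<^bsup>|O|\<^esup> = 1 + (q - 1) (\<Sum>s\<in>O. q\<^bsup>|{r\<in>O. r < s}|\<^esup>)\<close> over all \<open>\<pi>\<close> and decomposing each pair \<open>(\<pi>, s)\<close>
  into \<open>(L, \<sigma>)\<close> therefore yields
  \<open>F(x,q) = F(x) + (q - 1) F(x,q) x (F(x) - 1)\<close>, because there are \<open>(m - 1)!\<close> choices of \<open>\<sigma>\<close> for
  each \<open>m \<ge> 2\<close>. The identity holds over every commutative ring; the indeterminate \<open>q\<close> gives the
  distribution and \<open>q = 0\<close> gives the avoiders.
\<close>

section \<open>Occurrences are determined by their left end\<close>

text \<open>
  The right end \<open>t\<close> of the occurrence is left implicit: it is the position of the value \<open>n - s + 1\<close>,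
  which cannot lie before \<open>s\<close> because the entries there are larger.
\<close>

definition occ_starts :: "nat \<Rightarrow> (nat \<Rightarrow> nat) \<Rightarrow> nat set" where
  "occ_starts n \<pi> = {s\<in>{1..<n}. (\<forall>i\<in>{1..<s}. n - s + 1 < \<pi> i) \<and> \<pi> s = n - s}"

lemma finite_occ_starts [simp]: "finite (occ_starts n \<pi>)"
  by (simp add: occ_starts_def)

text \<open>
  The shaded boxes leave only three regions open: above \<open>\<pi> t\<close> on the left of \<open>s\<close>, and below \<open>\<pi> s\<close>
  in the other two columns.
\<close>

lemma mesh12_occurrences_iff:
  assumes "R = {(0,0), (0,1), (1,1), (1,2), (2,1), (2,2)}" and "\<pi> permutes {1..n}"
  shows "(s, t) \<in> mesh12_occurrences R n \<pi> \<longleftrightarrow>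
    s \<in> {1..n} \<and> t \<in> {1..n} \<and> s < t \<and> \<pi> s < \<pi> t \<and>
    (\<forall>i\<in>{1..<s}. \<pi> t < \<pi> i) \<and> (\<forall>i\<in>{s<..n}. i \<noteq> t \<longrightarrow> \<pi> i < \<pi> s)"
    (is "?lhs \<longleftrightarrow> ?rhs")
proof
  have range: "1 \<le> \<pi> i \<and> \<pi> i \<le> n" if "i \<in> {1..n}" for i
    using permutes_in_image[OF assms(2), of i] that by simp
  have inj: "\<pi> i = \<pi> j \<longleftrightarrow> i = j" for i j
    using permutes_inj[OF assms(2)] by (auto simp: inj_def)
  {
    assume L: ?lhs
    have st: "s \<in> {1..n}" "t \<in> {1..n}" "s < t" "\<pi> s < \<pi> t"
      using L by (auto simp: mesh12_occurrences_def)
    have boxes: "\<not> (0 < m \<and> m < s \<and> 0 < \<pi> m \<and> \<pi> m < \<pi> s)"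
       "\<not> (0 < m \<and> m < s \<and> \<pi> s < \<pi> m \<and> \<pi> m < \<pi> t)"
       "\<not> (s < m \<and> m < t \<and> \<pi> s < \<pi> m \<and> \<pi> m < \<pi> t)"
       "\<not> (s < m \<and> m < t \<and> \<pi> t < \<pi> m \<and> \<pi> m < n + 1)"
       "\<not> (t < m \<and> m < n + 1 \<and> \<pi> s < \<pi> m \<and> \<pi> m < \<pi> t)"
       "\<not> (t < m \<and> m < n + 1 \<and> \<pi> t < \<pi> m \<and> \<pi> m < n + 1)" if "m \<in> {1..n}" for m
      using L that unfolding mesh12_occurrences_def assms(1) by (auto simp: numeral_2_eq_2)
    have "\<pi> t < \<pi> i" if "i \<in> {1..<s}" for i
    proof -
      have i: "i \<in> {1..n}" "i < s" using that st by auto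
      then have "\<pi> i \<noteq> \<pi> s" "\<pi> i \<noteq> \<pi> t" using inj st by auto
      then show ?thesis using boxes(1,2)[OF i(1)] range[OF i(1)] i by auto
    qed
    moreover have "\<pi> i < \<pi> s" if "i \<in> {s<..n}" "i \<noteq> t" for i
    proof -
      have i: "i \<in> {1..n}" "s < i" using that st by auto
      then have "\<pi> i \<noteq> \<pi> s" "\<pi> i \<noteq> \<pi> t" using inj that st by auto
      then show ?thesis using boxes(3-6)[OF i(1)] range[OF i(1)] i that by auto
    qed
    ultimately show ?rhs using st by blast
  }
  {
    assume r: ?rhs
    then have "\<pi> s < \<pi> t" and l: "\<And>m. Suc 0 \<le> m \<Longrightarrow> m < s \<Longrightarrow> \<pi> t < \<pi> m"
      and g: "\<And>m. s < m \<Longrightarrow> m \<le> n \<Longrightarrow> m \<noteq> t \<Longrightarrow> \<pi> m < \<pi> s" by auto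
    then have left: "\<not> \<pi> m < \<pi> s \<and> \<not> \<pi> m < \<pi> t" if "Suc 0 \<le> m" "m < s" for m
      using l[OF that] by linarith
    have right: "\<not> \<pi> s < \<pi> m \<and> \<not> \<pi> t < \<pi> m" if "s < m" "m \<le> n" "m \<noteq> t" for m
      using g[OF that] \<open>\<pi> s < \<pi> t\<close> by linarith
    show ?lhs
      using r unfolding mesh12_occurrences_def assms(1)
      by (auto simp: numeral_2_eq_2 left right)
  }
qed

text \<open>
  The entries with value above a given \<open>v\<close> number \<open>n - v\<close>. Applied to \<open>v = \<pi> t\<close>, where they sit at
  the positions before \<open>s\<close>, and to \<open>v = \<pi> s\<close>, where \<open>t\<close> joins them, this pins down both values.
\<close>

lemma card_positions_above:
  assumes "\<pi> permutes {1..n}"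
  shows "card {i\<in>{1..n}. v < \<pi> i} = n - v"
proof -
  have "\<pi> ` {i\<in>{1..n}. v < \<pi> i} = {v<..n}"
  proof (intro subset_antisym subsetI)
    fix y assume "y \<in> {v<..n}"
    then have "y \<in> \<pi> ` {1..n}" "v < y" using permutes_image[OF assms] by auto
    then show "y \<in> \<pi> ` {i\<in>{1..n}. v < \<pi> i}" by auto
  qed (use permutes_in_image[OF assms] in auto)
  moreover have "inj_on \<pi> {i\<in>{1..n}. v < \<pi> i}"
    using permutes_inj[OF assms] by (rule inj_on_subset) simp
  ultimately show ?thesis by (metis card_greaterThanAtMost card_image)
qed

lemma occurrence_values:
  assumes "R = {(0,0), (0,1), (1,1), (1,2), (2,1), (2,2)}" and perm: "\<pi> permutes {1..n}"
    and occ: "(s, t) \<in> mesh12_occurrences R n \<pi>"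
  shows "\<pi> s = n - s" and "\<pi> t = n - s + 1"
proof -
  note o = occ[unfolded mesh12_occurrences_iff[OF assms(1,2)]]
  have below: "\<pi> i < \<pi> s" if "i \<in> {1..n}" "\<not> i < s" "i \<noteq> s" "i \<noteq> t" for i
    using o that by auto
  have above: "\<pi> t < \<pi> i" if "i \<in> {1..n}" "i < s" for i
    using o that by auto
  have "\<pi> s \<le> n" "\<pi> t \<le> n" using o permutes_in_image[OF perm] by (metis atLeastAtMost_iff)+
  have "{i\<in>{1..n}. \<pi> t < \<pi> i} = {1..<s}"
  proof (intro subset_antisym subsetI)
    fix i assume i: "i \<in> {i\<in>{1..n}. \<pi> t < \<pi> i}"
    then show "i \<in> {1..<s}" using below[of i] o by fastforce
  next
    fix i assume "i \<in> {1..<s}"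
    then show "i \<in> {i\<in>{1..n}. \<pi> t < \<pi> i}" using o above[of i] by fastforce
  qed
  then have "n - \<pi> t = s - 1" using card_positions_above[OF perm, of "\<pi> t"] by simp
  then show "\<pi> t = n - s + 1" using \<open>\<pi> t \<le> n\<close> o by auto
  have "{i\<in>{1..n}. \<pi> s < \<pi> i} = insert t {1..<s}"
  proof (intro subset_antisym subsetI)
    fix i assume i: "i \<in> {i\<in>{1..n}. \<pi> s < \<pi> i}"
    then show "i \<in> insert t {1..<s}" using below[of i] by fastforce
  next
    fix i assume "i \<in> insert t {1..<s}"
    then show "i \<in> {i\<in>{1..n}. \<pi> s < \<pi> i}" using o above[of i] by fastforce
  qed
  moreover have "card (insert t {1..<s}) = s" using o by auto
  ultimately have "n - \<pi> s = s" using card_positions_above[OF perm, of "\<pi> s"] by simp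
  then show "\<pi> s = n - s" using \<open>\<pi> s \<le> n\<close> by simp
qed

lemma mesh12_count_eq_card_occ_starts:
  assumes R: "R = {(0,0), (0,1), (1,1), (1,2), (2,1), (2,2)}" and perm: "\<pi> permutes {1..n}"
  shows "mesh12_count R n \<pi> = card (occ_starts n \<pi>)"
proof -
  let ?O = "mesh12_occurrences R n \<pi>"
  have inj: "\<pi> i = \<pi> j \<longleftrightarrow> i = j" for i j
    using permutes_inj[OF perm] by (auto simp: inj_def)
  have "inj_on fst ?O"
    by (intro inj_onI) (metis inj occurrence_values(2)[OF R perm] prod.collapse)
  moreover have "fst ` ?O = occ_starts n \<pi>"
  proof (intro subset_antisym subsetI)
    fix s assume "s \<in> fst ` ?O"
    then obtain t where st: "(s, t) \<in> ?O" by auto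
    note v = occurrence_values[OF R perm st]
    show "s \<in> occ_starts n \<pi>"
      using st[unfolded mesh12_occurrences_iff[OF R perm]] v by (auto simp: occ_starts_def)
  next
    fix s assume s: "s \<in> occ_starts n \<pi>"
    then have sn: "1 \<le> s" "s < n" and up: "\<And>i. 1 \<le> i \<Longrightarrow> i < s \<Longrightarrow> n - s + 1 < \<pi> i"
      and ps: "\<pi> s = n - s" by (auto simp: occ_starts_def)
    have "n - s + 1 \<in> \<pi> ` {1..n}" using sn permutes_image[OF perm] by auto
    then obtain t where t: "t \<in> {1..n}" "\<pi> t = n - s + 1" by auto
    have "s < t" using up[of t] t ps by (cases t s rule: linorder_cases) auto
    \<comment> \<open>The \<open>s - 1\<close> positions before \<open>s\<close> exhaust the positions holding the top \<open>s - 1\<close> values.\<close>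
    have top_eq: "{1..<s} = {i\<in>{1..n}. \<pi> t < \<pi> i}"
    proof (rule card_subset_eq)
      show "{1..<s} \<subseteq> {i\<in>{1..n}. \<pi> t < \<pi> i}" using up t sn by auto
      show "card {1..<s} = card {i\<in>{1..n}. \<pi> t < \<pi> i}"
        using card_positions_above[OF perm, of "\<pi> t"] t sn by simp
    qed simp
    have top: "i < s" if "i \<in> {1..n}" "\<pi> t < \<pi> i" for i
    proof -
      have "i \<in> {1..<s}" unfolding top_eq using that by blast
      then show ?thesis by simp
    qed
    have "\<pi> i < \<pi> s" if "i \<in> {s<..n}" "i \<noteq> t" for i
    proof -
      have "\<pi> i \<noteq> \<pi> s" "\<pi> i \<noteq> \<pi> t" using that inj by auto
      moreover have "\<not> \<pi> t < \<pi> i" using top[of i] that by auto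
      ultimately show ?thesis using t ps by linarith
    qed
    then have "(s, t) \<in> ?O"
      unfolding mesh12_occurrences_iff[OF R perm] using sn t ps up \<open>s < t\<close> by auto
    then show "s \<in> fst ` ?O" by force
  qed
  ultimately show ?thesis unfolding mesh12_count_def by (metis card_image)
qed

section \<open>Skew sums of permutations\<close>

definition skew_sum :: "nat \<Rightarrow> nat \<Rightarrow> (nat \<Rightarrow> nat) \<Rightarrow> (nat \<Rightarrow> nat) \<Rightarrow> nat \<Rightarrow> nat" where
  "skew_sum k m L \<sigma> i =
     (if i \<in> {1..k} then L i + m else if i \<in> {k<..k + m} then \<sigma> (i - k) else i)"

lemma finite_inj_imp_permutes:
  assumes "finite A" "inj_on f A" "\<And>x. x \<in> A \<Longrightarrow> f x \<in> A" "\<And>x. x \<notin> A \<Longrightarrow> f x = x"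
  shows "f permutes A"
proof (rule bij_imp_permutes)
  have "f ` A \<subseteq> A" using assms(3) by auto
  then have "f ` A = A" using assms(1,2) by (intro endo_inj_surj)
  then show "bij_betw f A A" using assms(2) by (simp add: bij_betw_def)
qed (use assms(4) in auto)

lemma skew_sum_permutes:
  assumes "L permutes {1..k}" "\<sigma> permutes {1..m}"
  shows "skew_sum k m L \<sigma> permutes {1..k + m}"
proof (rule finite_inj_imp_permutes)
  have L: "1 \<le> L i \<and> L i \<le> k" if "1 \<le> i" "i \<le> k" for i
    using permutes_in_image[OF assms(1), of i] that by simp
  have \<sigma>: "1 \<le> \<sigma> i \<and> \<sigma> i \<le> m" if "1 \<le> i" "i \<le> m" for i
    using permutes_in_image[OF assms(2), of i] that by simp
  have injL: "L i = L j \<longleftrightarrow> i = j" for i j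
    using permutes_inj[OF assms(1)] by (auto simp: inj_def)
  have inj\<sigma>: "\<sigma> i = \<sigma> j \<longleftrightarrow> i = j" for i j
    using permutes_inj[OF assms(2)] by (auto simp: inj_def)
  have left: "m < skew_sum k m L \<sigma> i" "skew_sum k m L \<sigma> i \<le> k + m" if "1 \<le> i" "i \<le> k" for i
    using L[OF that] that by (auto simp: skew_sum_def)
  have right: "1 \<le> skew_sum k m L \<sigma> i" "skew_sum k m L \<sigma> i \<le> m" if "k < i" "i \<le> k + m" for i
    using \<sigma>[of "i - k"] that by (auto simp: skew_sum_def)
  show "skew_sum k m L \<sigma> x \<in> {1..k + m}" if "x \<in> {1..k + m}" for x
    using left[of x] right[of x] that by (cases "x \<le> k") auto
  show "inj_on (skew_sum k m L \<sigma>) {1..k + m}"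
  proof (rule inj_onI)
    fix x y assume xy: "x \<in> {1..k + m}" "y \<in> {1..k + m}"
      and eq: "skew_sum k m L \<sigma> x = skew_sum k m L \<sigma> y"
    have "x \<le> k \<longleftrightarrow> y \<le> k" using left(1)[of x] right(2)[of x] left(1)[of y] right(2)[of y] xy eq
      by (cases "x \<le> k"; cases "y \<le> k") auto
    then show "x = y" using eq xy by (cases "x \<le> k") (auto simp: skew_sum_def injL inj\<sigma>)
  qed
  show "skew_sum k m L \<sigma> x = x" if "x \<notin> {1..k + m}" for x
    using that by (auto simp: skew_sum_def)
qed simp

text \<open>
  If the first \<open>k\<close> entries all exceed \<open>m\<close>, they are the \<open>k\<close> largest values, so the remaining
  entries form a permutation of \<open>{1..m}\<close>.
\<close>

lemma skew_sum_decomposition: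
  assumes perm: "\<pi> permutes {1..k + m}" and up: "\<forall>i\<in>{1..k}. m < \<pi> i"
  obtains L \<sigma> where "L permutes {1..k}" "\<sigma> permutes {1..m}" "\<pi> = skew_sum k m L \<sigma>"
proof
  define L where "L i = (if i \<in> {1..k} then \<pi> i - m else i)" for i
  define \<sigma> where "\<sigma> i = (if i \<in> {1..m} then \<pi> (i + k) else i)" for i
  have range: "1 \<le> \<pi> i \<and> \<pi> i \<le> k + m" if "1 \<le> i" "i \<le> k + m" for i
    using permutes_in_image[OF perm, of i] that by simp
  have inj: "\<pi> i = \<pi> j \<longleftrightarrow> i = j" for i j
    using permutes_inj[OF perm] by (auto simp: inj_def)
  have "{1..k} = {i\<in>{1..k + m}. m < \<pi> i}"
  proof (rule card_subset_eq)
    show "{1..k} \<subseteq> {i\<in>{1..k + m}. m < \<pi> i}" using up by auto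
    show "card {1..k} = card {i\<in>{1..k + m}. m < \<pi> i}"
      using card_positions_above[OF perm, of m] by simp
  qed simp
  then have low: "\<pi> i \<le> m" if "k < i" "i \<le> k + m" for i
    using that by (metis (no_types, lifting) atLeastAtMost_iff gr_implies_not0 leD leI
        less_one mem_Collect_eq)
  show "L permutes {1..k}"
  proof (rule finite_inj_imp_permutes)
    show "inj_on L {1..k}"
    proof (rule inj_onI)
      fix x y assume "x \<in> {1..k}" "y \<in> {1..k}" "L x = L y"
      moreover from this have "m < \<pi> x" "m < \<pi> y" using up by auto
      ultimately have "\<pi> x = \<pi> y" by (simp add: L_def)
      then show "x = y" by (simp add: inj)
    qed
    show "L x \<in> {1..k}" if "x \<in> {1..k}" for x
      using up range[of x] that by (auto simp: L_def Suc_le_eq)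
  qed (auto simp: L_def)
  show "\<sigma> permutes {1..m}"
  proof (rule finite_inj_imp_permutes)
    show "inj_on \<sigma> {1..m}" by (auto intro!: inj_onI simp: \<sigma>_def inj)
    show "\<sigma> x \<in> {1..m}" if "x \<in> {1..m}" for x
      using low[of "x + k"] range[of "x + k"] that by (auto simp: \<sigma>_def)
  qed (auto simp: \<sigma>_def)
  show "\<pi> = skew_sum k m L \<sigma>"
  proof
    fix i
    have "\<pi> i = i" if "i \<notin> {1..k + m}" using permutes_not_in[OF perm that] .
    moreover have "m \<le> \<pi> i" if "i \<in> {1..k}" using up that less_imp_le by blast
    ultimately show "\<pi> i = skew_sum k m L \<sigma> i"
      by (auto simp: skew_sum_def L_def \<sigma>_def)
  qed
qed

lemma skew_sum_inject:
  assumes "L permutes {1..k}" "\<sigma> permutes {1..m}" "L' permutes {1..k}" "\<sigma>' permutes {1..m}"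
    and eq: "skew_sum k m L \<sigma> = skew_sum k m L' \<sigma>'"
  shows "L = L' \<and> \<sigma> = \<sigma>'"
proof (intro conjI ext)
  fix i
  show "L i = L' i"
  proof (cases "i \<in> {1..k}")
    case True
    then show ?thesis using fun_cong[OF eq, of i] by (simp add: skew_sum_def)
  next
    case False
    then show ?thesis using assms by (simp add: permutes_not_in)
  qed
  show "\<sigma> i = \<sigma>' i"
  proof (cases "i \<in> {1..m}")
    case True
    then show ?thesis using fun_cong[OF eq, of "i + k"] by (simp add: skew_sum_def)
  next
    case False
    then show ?thesis using assms by (simp add: permutes_not_in)
  qed
qed

text \<open>
  At \<open>s = k\<close> the claim relies on the entries being positive: a start there would need
  \<open>L k = 0\<close>.
\<close>

lemma occ_starts_skew_sum_below:
  assumes "L permutes {1..k}"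
  shows "{r \<in> occ_starts (k + m) (skew_sum k m L \<sigma>). r < Suc k} = occ_starts k L"
proof (intro set_eqI)
  fix r
  have pos: "1 \<le> L i" if "1 \<le> i" "i \<le> k" for i
    using permutes_in_image[OF assms, of i] that by simp
  show "r \<in> {r \<in> occ_starts (k + m) (skew_sum k m L \<sigma>). r < Suc k} \<longleftrightarrow> r \<in> occ_starts k L"
  proof (cases "1 \<le> r \<and> r \<le> k")
    case False
    then show ?thesis by (auto simp: occ_starts_def)
  next
    case True
    have "(k + m - r + 1 < skew_sum k m L \<sigma> i) = (k - r + 1 < L i)" if "i \<in> {1..<r}" for i
      using that True by (auto simp: skew_sum_def)
    moreover have "(skew_sum k m L \<sigma> r = k + m - r) = (L r = k - r)"
      using True by (auto simp: skew_sum_def)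
    moreover have "r < k" if "L r = k - r" using pos[of r] that True by auto
    ultimately show ?thesis using True by (auto simp: occ_starts_def)
  qed
qed

lemma occ_starts_Suc_iff:
  assumes "2 \<le> m"
  shows "Suc k \<in> occ_starts (k + m) \<pi> \<longleftrightarrow> (\<forall>i\<in>{1..k}. m < \<pi> i) \<and> \<pi> (Suc k) = m - 1"
proof -
  have "k + m - Suc k = m - 1" "m - 1 + 1 = m" "{1..<Suc k} = {1..k}" using assms by auto
  then show ?thesis using assms unfolding occ_starts_def by (simp add: atLeastLessThanSuc_atLeastAtMost)
qed

text \<open>
  The restriction \<open>2 \<le> m\<close> reflects that an occurrence needs room for its two points: a block of
  size 1 would have to start with the value \<open>0\<close>.
\<close>

lemma bij_betw_skew_sum_occ_start:
  assumes "2 \<le> m"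
  shows "bij_betw (\<lambda>(L, \<sigma>). skew_sum k m L \<sigma>)
    (perms k \<times> {\<sigma> \<in> perms m. \<sigma> 1 = m - 1})
    {\<pi> \<in> perms (k + m). Suc k \<in> occ_starts (k + m) \<pi>}"
  (is "bij_betw ?f ?A ?B")
proof (rule bij_betw_imageI)
  show "inj_on ?f ?A"
    using skew_sum_inject by (fastforce intro!: inj_onI simp: perms_def)
  have at_start: "skew_sum k m L \<sigma> (Suc k) = \<sigma> 1" for L \<sigma>
    using assms by (simp add: skew_sum_def)
  show "?f ` ?A = ?B"
  proof (intro subset_antisym subsetI)
    fix \<pi> assume "\<pi> \<in> ?f ` ?A"
    then obtain L \<sigma> where p: "\<pi> = skew_sum k m L \<sigma>" "L permutes {1..k}" "\<sigma> permutes {1..m}"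
      "\<sigma> 1 = m - 1" by (auto simp: perms_def)
    have "m < \<pi> i" if "i \<in> {1..k}" for i
      using permutes_in_image[OF p(2), of i] that p(1) by (simp add: skew_sum_def)
    then show "\<pi> \<in> ?B"
      using skew_sum_permutes[OF p(2,3)] p(4) at_start
      by (simp add: perms_def occ_starts_Suc_iff[OF assms] p(1))
  next
    fix \<pi> assume "\<pi> \<in> ?B"
    then have p: "\<pi> permutes {1..k + m}" "\<forall>i\<in>{1..k}. m < \<pi> i" "\<pi> (Suc k) = m - 1"
      by (simp_all add: perms_def occ_starts_Suc_iff[OF assms])
    obtain L \<sigma> where "L permutes {1..k}" "\<sigma> permutes {1..m}" "\<pi> = skew_sum k m L \<sigma>"
      using skew_sum_decomposition[OF p(1,2)] .
    then show "\<pi> \<in> ?f ` ?A"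
      using p(3) at_start by (intro image_eqI[of _ _ "(L, \<sigma>)"]) (auto simp: perms_def)
  qed
qed

lemma card_permutes_fixed_value:
  assumes "finite S" "a \<in> S" "b \<in> S"
  shows "card {p. p permutes S \<and> p a = b} = fact (card S - 1)"
proof -
  have "{p. p permutes S \<and> p a = b} = (\<lambda>p. transpose a b \<circ> p) ` {p. p permutes (S - {a})}"
    (is "?A = ?g ` ?B")
  proof (intro subset_antisym subsetI)
    fix p assume "p \<in> ?A"
    then have p: "p permutes S" "p a = b" by auto
    have "transpose a b \<circ> p permutes S"
      using p(1) permutes_swap_id[OF assms(2,3)] by (rule permutes_compose)
    then have "transpose a b \<circ> p permutes (S - {a})"
      by (rule permutes_superset) (use p(2) in auto)
    moreover have "p = ?g (transpose a b \<circ> p)" by (simp add: fun_eq_iff)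
    ultimately show "p \<in> ?g ` ?B" by blast
  next
    fix p assume "p \<in> ?g ` ?B"
    then obtain p' where p': "p' permutes (S - {a})" "p = transpose a b \<circ> p'" by auto
    have "p' permutes S" using p'(1) by (rule permutes_subset) auto
    then have "p permutes S"
      unfolding p'(2) using permutes_swap_id[OF assms(2,3)] by (rule permutes_compose)
    moreover have "p' a = a" using p'(1) by (simp add: permutes_not_in)
    ultimately show "p \<in> ?A" using p'(2) by simp
  qed
  moreover have "inj_on ?g ?B"
    by (rule inj_onI) (auto simp: fun_eq_iff dest: injD[OF inj_transpose])
  moreover have "card ?B = fact (card S - 1)"
    using assms by (intro card_permutations) auto
  ultimately show ?thesis by (simp add: card_image)
qed

section \<open>The generating function equation\<close>

text \<open>
  Since the exponents \<open>card {y \<in> S. y < x}\<close> run through \<open>0, \<dots>, card S - 1\<close>, this is the geometric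
  sum.
\<close>

lemma power_card_telescope:
  fixes q :: "'a::comm_ring_1" and S :: "nat set"
  assumes "finite S"
  shows "q ^ card S = 1 + (q - 1) * (\<Sum>x\<in>S. q ^ card {y \<in> S. y < x})"
  using assms
proof (induction S rule: finite_linorder_max_induct)
  case empty
  then show ?case by simp
next
  case (insert b A)
  have "b \<notin> A" using insert by auto
  have "{y \<in> insert b A. y < b} = A" using insert by auto
  moreover have "{y \<in> insert b A. y < x} = {y \<in> A. y < x}" if "x \<in> A" for x
    using insert that by auto
  ultimately have sum: "(\<Sum>x\<in>insert b A. q ^ card {y \<in> insert b A. y < x})
      = q ^ card A + (\<Sum>x\<in>A. q ^ card {y \<in> A. y < x})"
    using insert \<open>b \<notin> A\<close> by simp
  have "q ^ card (insert b A) = q ^ card A + (q - 1) * q ^ card A"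
    using insert.hyps(1) \<open>b \<notin> A\<close> by (simp add: algebra_simps)
  also have "\<dots> = 1 + (q - 1) * (q ^ card A + (\<Sum>x\<in>A. q ^ card {y \<in> A. y < x}))"
    by (subst (1) insert.IH) (simp only: distrib_left ac_simps)
  finally show ?case unfolding sum .
qed

lemma finite_perms [simp]: "finite (perms n)"
  by (simp add: perms_def finite_permutations)

lemma card_perms: "card (perms n) = fact n"
  unfolding perms_def by (intro card_permutations) auto

definition occ_poly :: "'a::comm_ring_1 \<Rightarrow> nat \<Rightarrow> 'a" where
  "occ_poly q n = (\<Sum>\<pi>\<in>perms n. q ^ card (occ_starts n \<pi>))"

lemma sum_over_fixed_occ_start:
  fixes q :: "'a::comm_ring_1"
  assumes "2 \<le> m"
  shows "(\<Sum>\<pi> | \<pi> \<in> perms (k + m) \<and> Suc k \<in> occ_starts (k + m) \<pi>.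
            q ^ card {r \<in> occ_starts (k + m) \<pi>. r < Suc k})
         = occ_poly q k * of_nat (fact (m - 1))"
proof -
  let ?C = "{\<sigma> \<in> perms m. \<sigma> 1 = m - 1}"
  have "card ?C = fact (m - 1)"
    using card_permutes_fixed_value[of "{1..m}" 1 "m - 1"] assms by (simp add: perms_def)
  have "(\<Sum>\<pi> | \<pi> \<in> perms (k + m) \<and> Suc k \<in> occ_starts (k + m) \<pi>.
            q ^ card {r \<in> occ_starts (k + m) \<pi>. r < Suc k})
      = (\<Sum>(L, \<sigma>)\<in>perms k \<times> ?C.
            q ^ card {r \<in> occ_starts (k + m) (skew_sum k m L \<sigma>). r < Suc k})"
    by (subst sum.reindex_bij_betw[OF bij_betw_skew_sum_occ_start[OF assms], symmetric])
      (simp add: case_prod_beta)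
  also have "\<dots> = (\<Sum>(L, \<sigma>)\<in>perms k \<times> ?C. q ^ card (occ_starts k L))"
    by (intro sum.cong refl) (auto simp: perms_def occ_starts_skew_sum_below)
  also have "\<dots> = (\<Sum>L\<in>perms k. \<Sum>\<sigma>\<in>?C. q ^ card (occ_starts k L))"
    by (rule sum.cartesian_product[symmetric])
  also have "\<dots> = occ_poly q k * of_nat (card ?C)"
    by (simp add: occ_poly_def sum_distrib_right mult.commute)
  finally show ?thesis using \<open>card ?C = fact (m - 1)\<close> by simp
qed

lemma occ_poly_recurrence:
  fixes q :: "'a::comm_ring_1"
  shows "occ_poly q n = of_nat (fact n)
    + (q - 1) * (\<Sum>k\<in>{..<n - 1}. occ_poly q k * of_nat (fact (n - k - 1)))"
proof -
  let ?w = "\<lambda>\<pi> s. q ^ card {r \<in> occ_starts n \<pi>. r < s}"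
  have "occ_poly q n = (\<Sum>\<pi>\<in>perms n. 1 + (q - 1) * (\<Sum>s\<in>occ_starts n \<pi>. ?w \<pi> s))"
    unfolding occ_poly_def by (intro sum.cong refl power_card_telescope) simp
  also have "\<dots> = of_nat (fact n) + (q - 1) * (\<Sum>\<pi>\<in>perms n. \<Sum>s\<in>occ_starts n \<pi>. ?w \<pi> s)"
    by (simp add: sum.distrib sum_distrib_left card_perms)
  also have "(\<Sum>\<pi>\<in>perms n. \<Sum>s\<in>occ_starts n \<pi>. ?w \<pi> s)
      = (\<Sum>\<pi>\<in>perms n. \<Sum>s | s \<in> {1..<n} \<and> s \<in> occ_starts n \<pi>. ?w \<pi> s)"
    by (intro sum.cong refl) (auto simp: occ_starts_def)
  also have "\<dots> = (\<Sum>s\<in>{1..<n}. \<Sum>\<pi> | \<pi> \<in> perms n \<and> s \<in> occ_starts n \<pi>. ?w \<pi> s)"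
    by (rule sum.swap_restrict) auto
  also have "\<dots> = (\<Sum>k\<in>{..<n - 1}. \<Sum>\<pi> | \<pi> \<in> perms n \<and> Suc k \<in> occ_starts n \<pi>. ?w \<pi> (Suc k))"
    by (rule sum.reindex_bij_witness[of _ Suc "\<lambda>s. s - 1"]) auto
  also have "\<dots> = (\<Sum>k\<in>{..<n - 1}. occ_poly q k * of_nat (fact (n - k - 1)))"
  proof (intro sum.cong refl)
    fix k assume "k \<in> {..<n - 1}"
    then have "2 \<le> n - k" "k + (n - k) = n" by auto
    then show "(\<Sum>\<pi> | \<pi> \<in> perms n \<and> Suc k \<in> occ_starts n \<pi>. ?w \<pi> (Suc k))
        = occ_poly q k * of_nat (fact (n - k - 1))"
      using sum_over_fixed_occ_start[of "n - k" q k] by simp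
  qed
  finally show ?thesis .
qed

text \<open>
  The convolution in the recurrence is the product with \<open>x (F(x) - 1)\<close>, whose coefficient at \<open>x\<^sup>m\<close>
  is \<open>(m - 1)!\<close> for \<open>m \<ge> 2\<close> and \<open>0\<close> otherwise.
\<close>

lemma occ_poly_gf_equation:
  includes fps_syntax
  fixes q :: "'a::comm_ring_1"
  shows "Abs_fps (occ_poly q) * (1 + fps_const (1 - q) * fps_X * (fact_gf - 1)) = fact_gf"
proof -
  let ?P = "Abs_fps (occ_poly q)" and ?G = "fps_X * (fact_gf - 1) :: 'a fps"
  have G: "?G $ j = (if j < 2 then 0 else of_nat (fact (j - 1)))" for j
    by (simp add: fact_gf_def)
  have "?P = fact_gf + fps_const (q - 1) * (?P * ?G)"
  proof (rule fps_ext)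
    fix n
    have "(?P * ?G) $ n = (\<Sum>k\<in>{0..n}. occ_poly q k * ?G $ (n - k))"
      by (simp only: fps_mult_nth fps_nth_Abs_fps)
    also have "\<dots> = (\<Sum>k\<in>{..<n - 1}. occ_poly q k * ?G $ (n - k))"
      unfolding G by (intro sum.mono_neutral_right) auto
    also have "\<dots> = (\<Sum>k\<in>{..<n - 1}. occ_poly q k * of_nat (fact (n - k - 1)))"
      unfolding G by (intro sum.cong refl) auto
    finally have "(?P * ?G) $ n = (\<Sum>k\<in>{..<n - 1}. occ_poly q k * of_nat (fact (n - k - 1)))" .
    then show "?P $ n = (fact_gf + fps_const (q - 1) * (?P * ?G)) $ n"
      using occ_poly_recurrence[of q n] by (simp only: fps_add_nth fps_mult_left_const_nth
          fps_nth_Abs_fps fact_gf_def)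
  qed
  then have "?P - fps_const (q - 1) * (?P * ?G) = fact_gf"
    by (metis add_diff_cancel_right')
  moreover have "fps_const (1 - q) = - fps_const (q - 1)"
    by simp
  then have "?P * (1 + fps_const (1 - q) * fps_X * (fact_gf - 1))
      = ?P - fps_const (q - 1) * (?P * ?G)"
    by (simp only:) (simp add: algebra_simps del: fps_const_neg)
  ultimately show ?thesis by simp
qed

lemma occ_poly_gf:
  includes fps_syntax
  fixes q :: "'a::field"
  shows "Abs_fps (occ_poly q) = fact_gf / (1 + fps_const (1 - q) * fps_X * (fact_gf - 1))"
    (is "?P = _ / ?D")
proof -
  have "?D $ 0 = 1" by simp
  then have "?D \<noteq> 0" by (metis fps_zero_nth zero_neq_one)
  then have "?P = ?P * ?D / ?D" by simp
  then show ?thesis by (simp only: occ_poly_gf_equation)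
qed

theorem theorem3p9:
  fixes R :: "(nat \<times> nat) set"
  assumes "R = {(0,0), (0,1), (1,1), (1,2), (2,1), (2,2)}"
  shows "avoiders_gf R = fact_gf / (1 - fps_X + fps_X * fact_gf)
    \<and> mesh12_gf R =
           fact_gf / (1 + fps_const (1 - q_var) * fps_X * (fact_gf - 1))"
proof
  have count: "mesh12_count R n \<pi> = card (occ_starts n \<pi>)" if "\<pi> \<in> perms n" for n \<pi>
    using mesh12_count_eq_card_occ_starts[OF assms] that by (simp add: perms_def)
  have "mesh12_gf R = Abs_fps (occ_poly q_var)"
    unfolding mesh12_gf_def occ_poly_def using count by (simp cong: sum.cong)
  then show "mesh12_gf R = fact_gf / (1 + fps_const (1 - q_var) * fps_X * (fact_gf - 1))"
    by (simp only: occ_poly_gf)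
  \<comment> \<open>Because \<open>0 ^ 0 = 1\<close>, the weight \<open>q = 0\<close> is the indicator of the avoiders.\<close>
  have "of_nat (card (mesh12_avoiders R n)) = occ_poly (0 :: rat) n" for n
  proof -
    have "occ_poly (0 :: rat) n = (\<Sum>\<pi>\<in>perms n. if mesh12_count R n \<pi> = 0 then 1 else 0)"
      unfolding occ_poly_def by (intro sum.cong refl) (simp add: count power_0_left)
    then show ?thesis
      by (simp add: mesh12_avoiders_def sum.If_cases Int_def)
  qed
  then have "avoiders_gf R = Abs_fps (occ_poly 0)"
    by (simp add: avoiders_gf_def)
  then show "avoiders_gf R = fact_gf / (1 - fps_X + fps_X * fact_gf)"
    using occ_poly_gf[of "0 :: rat"] by (simp add: algebra_simps)
qed

end
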